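(* Let $\mathcal{A}$ be a C*-algebra, $E$ a Hilbert $\mathcal{A}$-module, $T\in\mathcal{L}(E)$ Moore-Penrose invertible, and $W$ a complemented submodule of $E$. If $W$ is a reducing submodule for $T$ and $0\notin\omega(T):=\{\langle Tx,x\rangle : x\in E,\ \|x\|=1\}$ (the C*-numerical range of $T$, a subset of $\mathcal{A}$), then $W$ is a reducing submodule for the Moore-Penrose inverse $T^{\dagger}$ of $T$.
   Context: Hilbert $\mathcal{A}$-modules are right Hilbert C*-modules with $\mathcal{A}$-valued inner product, linear in the second variable. $\mathcal{L}(E)$ is the C*-algebra of all adjointable operators on $E$. $T\in\mathcal{L}(E)$ is Moore-Penrose invertible if there is $X\in\mathcal{L}(E)$ with $TXT=T$, $XTX=X$, $(TX)^*=TX$, $(XT)^*=XT$; such $X$ is unique and denoted $T^{\dagger}$. For a submodule $W$, $W^{\perp}=\{y\in E:\langle x,y\rangle=0 \text{ for all } x\in W\}$. A closed submodule $W$ is complemented if $E=W\oplus W^{\perp}$. A closed submodule $W$ is $T$-invariant if $T(W)\subseteq W$, and is a reducing submodule for $T$ if both $W$ and $W^{\perp}$ are $T$-invariant. *)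

theory Defs
  imports "HOL-Analysis.Analysis"
begin

class scaleC =
  fixes scaleC :: "complex \<Rightarrow> 'a \<Rightarrow> 'a" (infixr "*\<^sub>C" 75)

class complex_normed_vector = real_normed_vector + scaleC +
  assumes scaleC_add_right: "c *\<^sub>C (x + y) = c *\<^sub>C x + c *\<^sub>C y"
    and scaleC_add_left: "(c + d) *\<^sub>C x = c *\<^sub>C x + d *\<^sub>C x"
    and scaleC_scaleC: "c *\<^sub>C (d *\<^sub>C x) = (c * d) *\<^sub>C x"
    and scaleC_of_real: "complex_of_real r *\<^sub>C x = r *\<^sub>R x"
    and norm_scaleC: "norm (c *\<^sub>C x) = cmod c * norm x"

class complex_banach = complex_normed_vector + banach

text \<open>C*-algebras are not assumed to be unital, and the zero algebra is allowed.\<close>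

class cstar_algebra = complex_banach + real_normed_algebra +
  fixes star :: "'a \<Rightarrow> 'a"
  assumes mult_scaleC_left: "(c *\<^sub>C a) * b = c *\<^sub>C (a * b)"
    and mult_scaleC_right: "a * (c *\<^sub>C b) = c *\<^sub>C (a * b)"
    and star_star: "star (star a) = a"
    and star_add: "star (a + b) = star a + star b"
    and star_scaleC: "star (c *\<^sub>C a) = cnj c *\<^sub>C star a"
    and star_mult: "star (a * b) = star b * star a"
    and cstar_identity: "norm (star a * a) = (norm a)\<^sup>2"

definition cstar_positive :: "'a::cstar_algebra \<Rightarrow> bool" where
  "cstar_positive a \<longleftrightarrow> (\<exists>b. a = star b * b)"

text \<open>The underlying Banach space of the module is the type \<^typ>\<open>'e\<close>; its norm is required to be the
  one induced by the inner product, so that \<open>banach\<close> expresses completeness of the module.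
  Definiteness of the inner product follows from \<open>norm_ip\<close>.\<close>

locale hilbert_cstar_module =
  fixes act :: "'e::complex_banach \<Rightarrow> 'a::cstar_algebra \<Rightarrow> 'e"
    and ip :: "'e \<Rightarrow> 'e \<Rightarrow> 'a"
  assumes act_add_left: "act (x + y) a = act x a + act y a"
    and act_add_right: "act x (a + b) = act x a + act x b"
    and act_mult: "act x (a * b) = act (act x a) b"
    and act_scaleC_left: "act (c *\<^sub>C x) a = c *\<^sub>C act x a"
    and act_scaleC_right: "act x (c *\<^sub>C a) = c *\<^sub>C act x a"
    and ip_add_right: "ip x (y + z) = ip x y + ip x z"
    and ip_scaleC_right: "ip x (c *\<^sub>C y) = c *\<^sub>C ip x y"
    and ip_act_right: "ip x (act y a) = ip x y * a"
    and ip_star: "star (ip x y) = ip y x"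
    and ip_positive: "cstar_positive (ip x x)"
    and norm_ip: "norm x = sqrt (norm (ip x x))"

text \<open>As usual for Hilbert modules, linearity and boundedness are not demanded of an
  adjointable map: they follow from the existence of an adjoint.\<close>

definition is_adjoint :: "('e \<Rightarrow> 'e \<Rightarrow> 'a) \<Rightarrow> ('e \<Rightarrow> 'e) \<Rightarrow> ('e \<Rightarrow> 'e) \<Rightarrow> bool" where
  "is_adjoint ip T S \<longleftrightarrow> (\<forall>x y. ip (T x) y = ip x (S y))"

definition adjointable :: "('e \<Rightarrow> 'e \<Rightarrow> 'a) \<Rightarrow> ('e \<Rightarrow> 'e) set" where
  "adjointable ip = {T. \<exists>S. is_adjoint ip T S}"

definition adj :: "('e \<Rightarrow> 'e \<Rightarrow> 'a) \<Rightarrow> ('e \<Rightarrow> 'e) \<Rightarrow> ('e \<Rightarrow> 'e)" where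
  "adj ip T = (THE S. is_adjoint ip T S)"

definition is_mp_inverse :: "('e \<Rightarrow> 'e \<Rightarrow> 'a) \<Rightarrow> ('e \<Rightarrow> 'e) \<Rightarrow> ('e \<Rightarrow> 'e) \<Rightarrow> bool" where
  "is_mp_inverse ip T X \<longleftrightarrow> X \<in> adjointable ip \<and>
     T \<circ> X \<circ> T = T \<and> X \<circ> T \<circ> X = X \<and>
     adj ip (T \<circ> X) = T \<circ> X \<and> adj ip (X \<circ> T) = X \<circ> T"

definition mp_invertible :: "('e \<Rightarrow> 'e \<Rightarrow> 'a) \<Rightarrow> ('e \<Rightarrow> 'e) \<Rightarrow> bool" where
  "mp_invertible ip T \<longleftrightarrow> (\<exists>X. is_mp_inverse ip T X)"

definition mp_inverse :: "('e \<Rightarrow> 'e \<Rightarrow> 'a) \<Rightarrow> ('e \<Rightarrow> 'e) \<Rightarrow> ('e \<Rightarrow> 'e)" where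
  "mp_inverse ip T = (THE X. is_mp_inverse ip T X)"

definition closed_submodule ::
    "('e::complex_banach \<Rightarrow> 'a::cstar_algebra \<Rightarrow> 'e) \<Rightarrow> 'e set \<Rightarrow> bool" where
  "closed_submodule act W \<longleftrightarrow> closed W \<and> 0 \<in> W \<and> (\<forall>x\<in>W. \<forall>y\<in>W. x + y \<in> W) \<and>
     (\<forall>c. \<forall>x\<in>W. c *\<^sub>C x \<in> W) \<and> (\<forall>x\<in>W. \<forall>a. act x a \<in> W)"

definition orth_compl :: "('e \<Rightarrow> 'e \<Rightarrow> 'a::zero) \<Rightarrow> 'e set \<Rightarrow> 'e set" where
  "orth_compl ip W = {y. \<forall>x\<in>W. ip x y = 0}"

definition complemented_submodule ::
    "('e::complex_banach \<Rightarrow> 'a::cstar_algebra \<Rightarrow> 'e) \<Rightarrow> ('e \<Rightarrow> 'e \<Rightarrow> 'a) \<Rightarrow> 'e set \<Rightarrow> bool" where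
  "complemented_submodule act ip W \<longleftrightarrow> closed_submodule act W \<and>
     (\<forall>x. \<exists>u\<in>W. \<exists>v\<in>orth_compl ip W. x = u + v) \<and> W \<inter> orth_compl ip W = {0}"

definition invariant_under :: "('e \<Rightarrow> 'e) \<Rightarrow> 'e set \<Rightarrow> bool" where
  "invariant_under T W \<longleftrightarrow> T ` W \<subseteq> W"

definition reducing_submodule ::
    "('e::complex_banach \<Rightarrow> 'a::cstar_algebra \<Rightarrow> 'e) \<Rightarrow> ('e \<Rightarrow> 'e \<Rightarrow> 'a) \<Rightarrow>
     ('e \<Rightarrow> 'e) \<Rightarrow> 'e set \<Rightarrow> bool" where
  "reducing_submodule act ip T W \<longleftrightarrow> closed_submodule act W \<and>
     invariant_under T W \<and> invariant_under T (orth_compl ip W)"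

definition cstar_numerical_range ::
    "('e::complex_banach \<Rightarrow> 'e \<Rightarrow> 'a) \<Rightarrow> ('e \<Rightarrow> 'e) \<Rightarrow> 'a set" where
  "cstar_numerical_range ip T = {ip (T x) x |x. norm x = 1}"

end

theory Submission
  imports Defs
begin

text \<open>
  If \<open>0 \<notin> \<omega>(T)\<close>, then both \<open>T\<close> and \<open>T*\<close> are injective, because \<open>\<langle>Tx, x\<rangle> = \<langle>x, T*x\<rangle>\<close>.
  With \<open>X\<close> a Moore-Penrose inverse, \<open>T(XT - 1) = 0\<close> and \<open>T*(TX - 1) = ((TX - 1)T)* = 0\<close> then give
  \<open>XT = TX = 1\<close>. If \<open>w \<in> W\<close> and \<open>Xw = u + v\<close> with \<open>u \<in> W\<close>, \<open>v \<in> W\<^sup>\<perp>\<close>, then \<open>Tv = w - Tu\<close> lies in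
  \<open>W \<inter> W\<^sup>\<perp> = 0\<close>, so \<open>v = 0\<close> and \<open>Xw \<in> W\<close>; the argument for \<open>W\<^sup>\<perp>\<close> is symmetric.
\<close>

lemma scaleC_zero_right [simp]: "c *\<^sub>C (0 :: 'a::complex_normed_vector) = 0"
  by (metis norm_scaleC norm_zero mult_zero_right norm_eq_zero)

lemma scaleC_minus_one: "(- 1) *\<^sub>C x = - (x :: 'a::complex_normed_vector)"
  using scaleC_of_real[of "-1" x] by simp

lemma star_zero [simp]: "star (0 :: 'a::cstar_algebra) = 0"
  using star_add[of 0 "0 :: 'a"] by simp

lemma star_eq_zero_iff [simp]: "star a = 0 \<longleftrightarrow> (a :: 'a::cstar_algebra) = 0"
  by (metis star_star star_zero)

lemma closed_submodule_diff:
  assumes "closed_submodule act W" "x \<in> W" "y \<in> W"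
  shows "x - y \<in> W"
proof -
  have "x + (- 1) *\<^sub>C y \<in> W"
    using assms unfolding closed_submodule_def by blast
  then show ?thesis
    by (simp add: scaleC_minus_one)
qed

context hilbert_cstar_module
begin

lemma ip_zero_right [simp]: "ip x 0 = 0"
  using ip_add_right[of x 0 0] by simp

lemma ip_diff_right: "ip x (y - z) = ip x y - ip x z"
  using ip_add_right[of x "y - z" z] by (simp add: algebra_simps)

lemma ip_eq_zero_commute: "ip x y = 0 \<longleftrightarrow> ip y x = 0"
  by (metis ip_star star_eq_zero_iff)

lemma ip_zero_left [simp]: "ip 0 y = 0"
  using ip_eq_zero_commute[of 0 y] by simp

lemma ip_self_eq_zero: "ip x x = 0 \<longleftrightarrow> x = 0"
  using norm_ip[of x] by auto

text \<open>Pairing \<open>y - z\<close> with itself and using definiteness gives the claim.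
  Identities between vectors are checked in this weak form below, notably for uniqueness of adjoints
  and linearity.\<close>

lemma eq_if_ip_eq:
  assumes "\<And>x. ip x y = ip x z"
  shows "y = z"
  using assms ip_self_eq_zero[of "y - z"] ip_diff_right[of "y - z" y z] by simp

lemma is_adjoint_sym:
  assumes "is_adjoint ip T S"
  shows "is_adjoint ip S T"
  unfolding is_adjoint_def
proof (intro allI)
  fix x y
  have "ip (S x) y = star (ip y (S x))"
    by (rule ip_star[symmetric])
  also have "\<dots> = star (ip (T y) x)"
    using assms by (simp add: is_adjoint_def)
  also have "\<dots> = ip x (T y)"
    by (rule ip_star)
  finally show "ip (S x) y = ip x (T y)" .
qed

lemma is_adjoint_unique:
  assumes "is_adjoint ip T S" "is_adjoint ip T S'"
  shows "S = S'"
proof (intro ext eq_if_ip_eq)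
  show "ip x (S y) = ip x (S' y)" for x y
    using assms unfolding is_adjoint_def by (metis (no_types))
qed

lemma is_adjoint_comp:
  assumes "is_adjoint ip T T'" "is_adjoint ip S S'"
  shows "is_adjoint ip (T \<circ> S) (S' \<circ> T')"
  using assms unfolding is_adjoint_def by simp

lemma is_adjoint_adj:
  assumes "T \<in> adjointable ip"
  shows "is_adjoint ip T (adj ip T)"
proof -
  obtain S where S: "is_adjoint ip T S"
    using assms unfolding adjointable_def by blast
  have "adj ip T = S"
    unfolding adj_def using S is_adjoint_unique[OF _ S] by (rule the_equality)
  with S show ?thesis
    by simp
qed

lemma ip_adj_left:
  assumes "T \<in> adjointable ip"
  shows "ip (adj ip T x) y = ip x (T y)"
  using is_adjoint_sym[OF is_adjoint_adj[OF assms]] by (simp add: is_adjoint_def)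

lemma adjointable_comp:
  assumes "T \<in> adjointable ip" "S \<in> adjointable ip"
  shows "T \<circ> S \<in> adjointable ip"
  using assms is_adjoint_comp unfolding adjointable_def by blast

text \<open>Linearity is not built into \<open>adjointable\<close>: moving \<open>T\<close> to the
  other slot as its adjoint leaves a pairing that is additive in its second variable.\<close>

lemma adjointable_add:
  assumes "T \<in> adjointable ip"
  shows "T (x + y) = T x + T y"
proof (rule eq_if_ip_eq)
  fix z
  show "ip z (T (x + y)) = ip z (T x + T y)"
    by (simp add: ip_adj_left[OF assms, symmetric] ip_add_right)
qed

lemma adjointable_scaleC:
  assumes "T \<in> adjointable ip"
  shows "T (c *\<^sub>C x) = c *\<^sub>C T x"
proof (rule eq_if_ip_eq)
  fix z
  show "ip z (T (c *\<^sub>C x)) = ip z (c *\<^sub>C T x)"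
    by (simp add: ip_adj_left[OF assms, symmetric] ip_scaleC_right)
qed

lemma adjointable_diff:
  assumes "T \<in> adjointable ip"
  shows "T (x - y) = T x - T y"
  using adjointable_add[OF assms, of "x - y" y] by (simp add: algebra_simps)

lemma orth_compl_diff:
  assumes "x \<in> orth_compl ip W" "y \<in> orth_compl ip W"
  shows "x - y \<in> orth_compl ip W"
  using assms by (simp add: orth_compl_def ip_diff_right)

text \<open>The numerical range only tests unit vectors, so a nonzero \<open>x\<close> is rescaled
  to norm 1, which keeps the pairing zero.\<close>

lemma zero_if_ip_eq_zero:
  assumes T: "T \<in> adjointable ip" and 0: "0 \<notin> cstar_numerical_range ip T"
    and x: "ip (T x) x = 0"
  shows "x = 0"
proof (rule ccontr)
  assume "x \<noteq> 0"
  define c where "c = complex_of_real (inverse (norm x))"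
  have "norm (c *\<^sub>C x) = 1"
    using \<open>x \<noteq> 0\<close> by (simp add: c_def norm_scaleC norm_inverse)
  moreover have "ip (T (c *\<^sub>C x)) (c *\<^sub>C x) = 0"
  proof -
    \<comment> \<open>Scalars leave \<open>ip\<close> only through its second slot, so the two
      factors \<open>c\<close> are pulled out one at a time, with a swap of the arguments in
      between.\<close>
    have "ip (T x) (c *\<^sub>C x) = 0"
      by (simp add: ip_scaleC_right x)
    then have "ip (c *\<^sub>C x) (T (c *\<^sub>C x)) = 0"
      using ip_eq_zero_commute[of "T x" "c *\<^sub>C x"]
      by (simp add: adjointable_scaleC[OF T] ip_scaleC_right)
    then show ?thesis
      using ip_eq_zero_commute[of "c *\<^sub>C x"] by blast
  qed
  ultimately show False
    using 0 unfolding cstar_numerical_range_def by force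
qed

lemma mp_inverse_is_inverse:
  assumes T: "T \<in> adjointable ip" and 0: "0 \<notin> cstar_numerical_range ip T"
    and X: "is_mp_inverse ip T X"
  shows "X (T x) = x" and "T (X x) = x"
proof -
  have XA: "X \<in> adjointable ip"
    and TXT: "T (X (T y)) = T y" and adj_TX: "adj ip (T \<circ> X) = T \<circ> X" for y
    using X unfolding is_mp_inverse_def by (auto simp: fun_eq_iff)
  have "T (X (T x) - x) = 0"
    by (simp add: adjointable_diff[OF T] TXT)
  then have "ip (T (X (T x) - x)) (X (T x) - x) = 0"
    by simp
  then show "X (T x) = x"
    using zero_if_ip_eq_zero[OF T 0] by fastforce
  have self_adj: "ip (T (X y)) z = ip y (T (X z))" for y z
    using is_adjoint_adj[OF adjointable_comp[OF T XA]]
    unfolding adj_TX is_adjoint_def by simp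
  \<comment> \<open>Weak form of T*(TXx - x) = 0. Choosing \<open>y\<close> as
    \<open>T (X x) - x\<close> itself produces a pairing governed by the numerical range.\<close>
  have "ip (T y) (T (X x) - x) = 0" for y
    using self_adj[of "T y" x] by (simp add: ip_diff_right TXT)
  then show "T (X x) = x"
    using zero_if_ip_eq_zero[OF T 0] by fastforce
qed

text \<open>The description defining \<open>mp_inverse\<close> needs uniqueness. Here all candidates
  are two-sided inverses of \<open>T\<close>, so Y = Y(TX) = (YT)X = X.\<close>

lemma is_mp_inverse_mp_inverse:
  assumes T: "T \<in> adjointable ip" and 0: "0 \<notin> cstar_numerical_range ip T"
    and "mp_invertible ip T"
  shows "is_mp_inverse ip T (mp_inverse ip T)"
proof -
  obtain X where X: "is_mp_inverse ip T X"
    using assms(3) unfolding mp_invertible_def by blast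
  have "Y = X" if "is_mp_inverse ip T Y" for Y
    using mp_inverse_is_inverse[OF T 0 X] mp_inverse_is_inverse[OF T 0 that]
    by (intro ext) metis
  with X show ?thesis
    unfolding mp_inverse_def by (rule theI)
qed

lemma reducing_submodule_inverse:
  assumes T: "T \<in> adjointable ip"
    and XT: "\<And>x. X (T x) = x" and TX: "\<And>x. T (X x) = x"
    and compl: "complemented_submodule act ip W"
    and red: "reducing_submodule act ip T W"
  shows "reducing_submodule act ip X W"
proof -
  let ?V = "orth_compl ip W"
  have W: "closed_submodule act W"
    and dec: "\<exists>u\<in>W. \<exists>v\<in>?V. x = u + v" and disj: "W \<inter> ?V = {0}" for x
    using compl unfolding complemented_submodule_def by auto
  have TW: "T u \<in> W" if "u \<in> W" for u
    using red that unfolding reducing_submodule_def invariant_under_def by auto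
  have TV: "T v \<in> ?V" if "v \<in> ?V" for v
    using red that unfolding reducing_submodule_def invariant_under_def by auto
  \<comment> \<open>\<open>T 0 = 0\<close> comes from additivity; then both \<open>x\<close> and
    \<open>0\<close> equal \<open>X 0\<close>.\<close>
  have inj0: "x = 0" if "T x = 0" for x
    using XT[of x] XT[of 0] adjointable_diff[OF T, of 0 0] that by simp
  have "X w \<in> W" if "w \<in> W" for w
  proof -
    obtain u v where uv: "u \<in> W" "v \<in> ?V" "X w = u + v"
      using dec by blast
    then have "T v = w - T u"
      using TX[of w] by (simp add: adjointable_add[OF T] algebra_simps)
    then have "T v \<in> W"
      using closed_submodule_diff[OF W \<open>w \<in> W\<close> TW[OF uv(1)]] by simp
    then have "T v = 0"
      using TV[OF uv(2)] disj by blast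
    then have "v = 0"
      by (rule inj0)
    then show ?thesis
      using uv by simp
  qed
  moreover have "X w \<in> ?V" if "w \<in> ?V" for w
  proof -
    obtain u v where uv: "u \<in> W" "v \<in> ?V" "X w = u + v"
      using dec by blast
    \<comment> \<open>Now the component in \<open>W\<close> has to vanish: its image stays in
      \<open>W\<close>, and this equation also puts it in the orthogonal complement.\<close>
    then have "T u = w - T v"
      using TX[of w] by (simp add: adjointable_add[OF T] algebra_simps)
    then have "T u \<in> ?V"
      using orth_compl_diff[OF \<open>w \<in> ?V\<close> TV[OF uv(2)]] by simp
    then have "T u = 0"
      using TW[OF uv(1)] disj by blast
    then have "u = 0"
      by (rule inj0)
    then show ?thesis
      using uv by simp
  qed
  ultimately show ?thesis
    using W unfolding reducing_submodule_def invariant_under_def by auto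
qed

end

theorem theorem2p12:
  fixes act :: "'e::complex_banach \<Rightarrow> 'a::cstar_algebra \<Rightarrow> 'e"
    and ip :: "'e \<Rightarrow> 'e \<Rightarrow> 'a"
    and T :: "'e \<Rightarrow> 'e"
    and W :: "'e set"
  assumes "hilbert_cstar_module act ip"
    and "T \<in> adjointable ip"
    and "mp_invertible ip T"
    and "complemented_submodule act ip W"
    and "reducing_submodule act ip T W"
    and "0 \<notin> cstar_numerical_range ip T"
  shows "reducing_submodule act ip (mp_inverse ip T) W"
proof -
  interpret hilbert_cstar_module act ip
    by fact
  note X = is_mp_inverse_mp_inverse[OF assms(2,6,3)]
  show ?thesis
    by (rule reducing_submodule_inverse[OF assms(2) mp_inverse_is_inverse[OF assms(2,6) X]
          assms(4,5)])
qed

end
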